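(* Let $\{\alpha_k\}_{k\ge0}$, $\{\beta_k\}_{k\ge0}$, $\{\gamma_k\}_{k\ge0}$ be real sequences and put $\widetilde\alpha_k=\beta_k\alpha_k+(\gamma_k-\beta_k)\alpha_{k+1}$. Suppose that the following conditions jointly hold: (i) $\lim_k\beta_k=\beta$ and $\lim_k\gamma_k=\gamma$ with $\beta>\gamma/2>0$; (ii) $\alpha_k>0$ for all $k$, $\alpha_k=\Omega(k)$, $\lim_k\alpha_{k+1}/\alpha_k=1$, and $\alpha_{k+1}(\alpha_{k+1}-1)\le\alpha_k^2$ for all $k$; (iii) the sequence $\{\widetilde\alpha_k/\alpha_k\}$ is monotone (either non-increasing or non-decreasing) in $k$. Then there exist constants $C,C_0>0$ and $K\ge1$, depending only on $\{\alpha_k\}$, $\{\beta_k\}$ and $\{\gamma_k\}$, such that for all $L>0$, all $f\in\mathcal F^1_L$, all $x_0\in\mathbb R^n$, all $0<s\le C_0/L$ and all $k\ge K$, the iterates $\{x_k\}$ of algorithm $(\mathcal B)$ (defined in the context) satisfy $$f(x_k)-f^*\le C\,\frac{\|x_0-x^*\|^2}{sk^2}\qquad\text{and}\qquad \min_{0\le i\le k}\|\nabla f(x_i)\|^2\le C\,\frac{\|x_0-x^*\|^2}{s^2(k+1)^3}.$$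
   Context: $\mathcal F^1_L$ is the set of continuously differentiable convex functions $f:\mathbb R^n\to\mathbb R$ that are $L$-smooth ($\|\nabla f(y)-\nabla f(x)\|\le L\|y-x\|$ for all $x,y$, Euclidean norm). It is assumed throughout that $f$ has a minimizer; $x^*$ denotes one of the minimizers and $f^*=f(x^* )$. $\alpha_k=\Omega(k)$ means that there are $c>0$ and $k_0\ge1$ with $\alpha_k\ge ck$ for $k\ge k_0$. Algorithm $(\mathcal B)$ with stepsize $s>0$: starting from $x_0=y_0$, for $k\ge0$, $$y_{k+1}=x_k-\beta_ks\nabla f(x_k),\qquad x_{k+1}=x_k-\gamma_ks\nabla f(x_k)+\sigma_{k+1}(y_{k+1}-y_k),\qquad \sigma_{k+1}=\frac{\alpha_k-1}{\alpha_{k+1}}.$$ Equivalently, with $z_k=\alpha_kx_k+(1-\alpha_k)y_k$ and $z_0=x_0$: $$y_{k+1}=x_k-\beta_ks\nabla f(x_k),\qquad z_{k+1}=z_k-\widetilde\alpha_ks\nabla f(x_k),\qquad x_{k+1}=\frac1{\alpha_{k+1}}z_{k+1}+\Big(1-\frac1{\alpha_{k+1}}\Big)y_{k+1}.$$ *)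

theory Defs
  imports "HOL-Analysis.Analysis"
begin

text \<open>
  The constants in the theorem must not depend on the dimension \<open>n\<close>, so \<open>n\<close> has to be
  quantified inside the formula and cannot be a type parameter. All spaces \<open>\<real>\<^sup>n\<close> are therefore
  realized inside one inner product space, the finitely supported real sequences: \<open>Rn n\<close> consists
  of the sequences that vanish from index \<open>n\<close> on, with the Euclidean inner product.
\<close>

typedef fsseq = "{x :: nat \<Rightarrow> real. finite {i. x i \<noteq> 0}}"
  morphisms coord Abs_fsseq
  by (rule exI[of _ "\<lambda>_. 0"]) simp

setup_lifting type_definition_fsseq

lemma finite_support [simp]: "finite {i. coord x i \<noteq> 0}"
  using coord[of x] by simp

lemma fsseq_eqI: "(\<And>i. coord x i = coord y i) \<Longrightarrow> x = y"
  by (simp add: coord_inject[symmetric] fun_eq_iff)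

instantiation fsseq :: real_vector
begin

lift_definition zero_fsseq :: fsseq is "\<lambda>_. 0"
  by simp

lift_definition plus_fsseq :: "fsseq \<Rightarrow> fsseq \<Rightarrow> fsseq" is "\<lambda>x y i. x i + y i"
  subgoal for x y
    by (rule finite_subset[of _ "{i. x i \<noteq> 0} \<union> {i. y i \<noteq> 0}"]) auto
  done

lift_definition minus_fsseq :: "fsseq \<Rightarrow> fsseq \<Rightarrow> fsseq" is "\<lambda>x y i. x i - y i"
  subgoal for x y
    by (rule finite_subset[of _ "{i. x i \<noteq> 0} \<union> {i. y i \<noteq> 0}"]) auto
  done

lift_definition uminus_fsseq :: "fsseq \<Rightarrow> fsseq" is "\<lambda>x i. - x i"
  by simp

lift_definition scaleR_fsseq :: "real \<Rightarrow> fsseq \<Rightarrow> fsseq" is "\<lambda>r x i. r * x i"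
  subgoal for r x
    by (rule finite_subset[of _ "{i. x i \<noteq> 0}"]) auto
  done

instance
  by standard (transfer, simp add: algebra_simps fun_eq_iff)+

end

lemmas coord_simps [simp] =
  zero_fsseq.rep_eq plus_fsseq.rep_eq minus_fsseq.rep_eq uminus_fsseq.rep_eq scaleR_fsseq.rep_eq

instantiation fsseq :: real_inner
begin

definition inner_fsseq :: "fsseq \<Rightarrow> fsseq \<Rightarrow> real"
  where "inner_fsseq x y = (\<Sum>i | coord x i \<noteq> 0. coord x i * coord y i)"

definition norm_fsseq :: "fsseq \<Rightarrow> real"
  where "norm_fsseq x = sqrt (inner x x)"

definition sgn_fsseq :: "fsseq \<Rightarrow> fsseq"
  where "sgn_fsseq x = x /\<^sub>R norm x"

definition dist_fsseq :: "fsseq \<Rightarrow> fsseq \<Rightarrow> real"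
  where "dist_fsseq x y = norm (x - y)"

definition uniformity_fsseq :: "(fsseq \<times> fsseq) filter"
  where "uniformity_fsseq = (INF e\<in>{0 <..}. principal {(x, y). dist x y < e})"

definition open_fsseq :: "fsseq set \<Rightarrow> bool"
  where "open_fsseq U \<longleftrightarrow> (\<forall>x\<in>U. eventually (\<lambda>(x', y). x' = x \<longrightarrow> y \<in> U) uniformity)"

lemma inner_fsseq_superset:
  assumes "finite A" "{i. coord x i \<noteq> 0} \<subseteq> A"
  shows "inner x y = (\<Sum>i\<in>A. coord x i * coord y i)"
  unfolding inner_fsseq_def using assms by (intro sum.mono_neutral_left) auto

instance
proof
  fix x y z :: fsseq and r :: real and U :: "fsseq set"
  let ?S = "\<lambda>x. {i. coord x i \<noteq> 0}"
  let ?A = "?S x \<union> ?S y"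
  have A: "finite ?A" by simp
  show "dist x y = norm (x - y)" by (rule dist_fsseq_def)
  show "sgn x = x /\<^sub>R norm x" by (rule sgn_fsseq_def)
  show "uniformity = (INF e\<in>{0 <..}. principal {(x, y :: fsseq). dist x y < e})"
    by (rule uniformity_fsseq_def)
  show "open U \<longleftrightarrow> (\<forall>x\<in>U. eventually (\<lambda>(x', y). x' = x \<longrightarrow> y \<in> U) uniformity)"
    by (rule open_fsseq_def)
  show "norm x = sqrt (inner x x)" by (rule norm_fsseq_def)
  show "inner x y = inner y x"
    using inner_fsseq_superset[OF A, of x y] inner_fsseq_superset[OF A, of y x]
    by (simp add: mult.commute)
  have "?S (x + y) \<subseteq> ?A" by auto
  then show "inner (x + y) z = inner x z + inner y z"
    using inner_fsseq_superset[OF A, of "x + y" z] inner_fsseq_superset[OF A, of x z]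
      inner_fsseq_superset[OF A, of y z]
    by (simp add: sum.distrib distrib_right)
  have "?S (r *\<^sub>R x) \<subseteq> ?S x" by auto
  then show "inner (r *\<^sub>R x) y = r * inner x y"
    using inner_fsseq_superset[of "?S x" "r *\<^sub>R x" y]
    by (simp add: inner_fsseq_def sum_distrib_left mult.assoc)
  show "0 \<le> inner x x"
    by (simp add: inner_fsseq_def sum_nonneg)
  show "inner x x = 0 \<longleftrightarrow> x = 0"
    by (auto simp: inner_fsseq_def sum_nonneg_eq_0_iff intro: fsseq_eqI)
qed

end

definition Rn :: "nat \<Rightarrow> fsseq set"
  where "Rn n = {x. \<forall>i\<ge>n. coord x i = 0}"

lemma inner_Rn:
  assumes "x \<in> Rn n"
  shows "inner x y = (\<Sum>i<n. coord x i * coord y i)"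
  using assms by (intro inner_fsseq_superset) (auto simp: Rn_def not_le[symmetric])

lemma norm_Rn:
  assumes "x \<in> Rn n"
  shows "norm x = sqrt (\<Sum>i<n. (coord x i)\<^sup>2)"
  using assms by (simp add: norm_eq_sqrt_inner inner_Rn power2_eq_square)

lemma coord_surj_Rn: "\<exists>x\<in>Rn n. \<forall>i<n. coord x i = a i"
proof -
  have "finite {i. (if i < n then a i else 0) \<noteq> 0}"
    by (rule finite_subset[of _ "{..<n}"]) (auto split: if_splits)
  then have "coord (Abs_fsseq (\<lambda>i. if i < n then a i else 0)) = (\<lambda>i. if i < n then a i else 0)"
    by (intro Abs_fsseq_inverse) simp
  then show ?thesis
    by (intro bexI[of _ "Abs_fsseq (\<lambda>i. if i < n then a i else 0)"]) (simp_all add: Rn_def)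
qed

lemma subspace_Rn: "subspace (Rn n)"
  by (auto simp: subspace_def Rn_def)

text \<open>
  A function \<open>f : \<real>\<^sup>n \<rightarrow> \<real>\<close> is a function on \<^typ>\<open>fsseq\<close> of which only the values on \<^term>\<open>Rn n\<close>
  matter; differentiability is Frechet differentiability relative to \<^term>\<open>Rn n\<close>.
\<close>

definition has_gradient :: "nat \<Rightarrow> (fsseq \<Rightarrow> real) \<Rightarrow> fsseq \<Rightarrow> fsseq \<Rightarrow> bool"
  where "has_gradient n f x g \<longleftrightarrow>
    g \<in> Rn n \<and> (f has_derivative (\<lambda>h. inner g h)) (at x within Rn n)"

definition grad :: "nat \<Rightarrow> (fsseq \<Rightarrow> real) \<Rightarrow> fsseq \<Rightarrow> fsseq"
  where "grad n f x = (THE g. has_gradient n f x g)"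

lemma has_gradient_unique:
  assumes x: "x \<in> Rn n" and g: "has_gradient n f x g" and g': "has_gradient n f x g'"
  shows "g = g'"
proof -
  define d where "d = g - g'"
  have dR: "d \<in> Rn n"
    using g g' unfolding d_def has_gradient_def by (auto intro: subspace_diff[OF subspace_Rn])
  have line: "((\<lambda>t. f (x + t *\<^sub>R d)) has_derivative (\<lambda>t. inner e (t *\<^sub>R d))) (at 0)"
    if "has_gradient n f x e" for e
  proof -
    have "((\<lambda>t. x + t *\<^sub>R d) has_derivative (\<lambda>t. t *\<^sub>R d)) (at 0)"
      by (auto intro!: derivative_eq_intros)
    moreover have "range (\<lambda>t. x + t *\<^sub>R d) \<subseteq> Rn n"
      using x dR by (auto intro!: subspace_add[OF subspace_Rn] subspace_scale[OF subspace_Rn])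
    then have "(f has_derivative (\<lambda>h. inner e h))
        (at (x + 0 *\<^sub>R d) within range (\<lambda>t. x + t *\<^sub>R d))"
      using that by (auto simp: has_gradient_def intro: has_derivative_subset)
    ultimately show ?thesis
      using has_derivative_in_compose[of "\<lambda>t. x + t *\<^sub>R d" "\<lambda>t. t *\<^sub>R d" 0 UNIV f "inner e"]
      by simp
  qed
  have "(\<lambda>t. inner g (t *\<^sub>R d)) = (\<lambda>t. inner g' (t *\<^sub>R d))"
    by (rule has_derivative_unique[OF line[OF g] line[OF g']])
  then have "inner g (1 *\<^sub>R d) = inner g' (1 *\<^sub>R d)"
    by (rule fun_cong)
  then have "inner d d = 0"
    by (simp add: d_def inner_diff_left)
  then show ?thesis
    by (simp add: d_def)
qed

lemma grad_eq:
  assumes "x \<in> Rn n" "has_gradient n f x g"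
  shows "grad n f x = g"
  unfolding grad_def using assms has_gradient_unique by blast

definition F1 :: "nat \<Rightarrow> real \<Rightarrow> (fsseq \<Rightarrow> real) set"
  where "F1 n L = {f.
    (\<forall>x\<in>Rn n. \<exists>g. has_gradient n f x g) \<and>
    continuous_on (Rn n) (grad n f) \<and>
    convex_on (Rn n) f \<and>
    (\<forall>x\<in>Rn n. \<forall>y\<in>Rn n. norm (grad n f y - grad n f x) \<le> L * norm (y - x))}"

definition minimizer :: "nat \<Rightarrow> (fsseq \<Rightarrow> real) \<Rightarrow> fsseq \<Rightarrow> bool"
  where "minimizer n f xs \<longleftrightarrow> xs \<in> Rn n \<and> (\<forall>x\<in>Rn n. f xs \<le> f x)"

text \<open>\<open>algB \<alpha> \<beta> \<gamma> s G x0 k\<close> is the pair \<open>(x\<^sub>k, y\<^sub>k)\<close> of the algorithm, where \<open>G\<close> is the gradient map.\<close>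

primrec algB :: "(nat \<Rightarrow> real) \<Rightarrow> (nat \<Rightarrow> real) \<Rightarrow> (nat \<Rightarrow> real) \<Rightarrow> real
    \<Rightarrow> (fsseq \<Rightarrow> fsseq) \<Rightarrow> fsseq \<Rightarrow> nat \<Rightarrow> fsseq \<times> fsseq"
  where
    "algB \<alpha> \<beta> \<gamma> s G x0 0 = (x0, x0)"
  | "algB \<alpha> \<beta> \<gamma> s G x0 (Suc k) =
      (let (x, y) = algB \<alpha> \<beta> \<gamma> s G x0 k;
           y' = x - (\<beta> k * s) *\<^sub>R G x;
           \<sigma> = (\<alpha> k - 1) / \<alpha> (Suc k);
           x' = x - (\<gamma> k * s) *\<^sub>R G x + \<sigma> *\<^sub>R (y' - y)
       in (x', y'))"

definition iterB :: "(nat \<Rightarrow> real) \<Rightarrow> (nat \<Rightarrow> real) \<Rightarrow> (nat \<Rightarrow> real) \<Rightarrow> real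
    \<Rightarrow> nat \<Rightarrow> (fsseq \<Rightarrow> real) \<Rightarrow> fsseq \<Rightarrow> nat \<Rightarrow> fsseq"
  where "iterB \<alpha> \<beta> \<gamma> s n f x0 k = fst (algB \<alpha> \<beta> \<gamma> s (grad n f) x0 k)"

definition alpha_tilde :: "(nat \<Rightarrow> real) \<Rightarrow> (nat \<Rightarrow> real) \<Rightarrow> (nat \<Rightarrow> real) \<Rightarrow> nat \<Rightarrow> real"
  where "alpha_tilde \<alpha> \<beta> \<gamma> k = \<beta> k * \<alpha> k + (\<gamma> k - \<beta> k) * \<alpha> (Suc k)"

end

theory Submission
  imports Defs
begin

text \<open>
  Write \<open>g\<^sub>k = \<nabla>f(x\<^sub>k)\<close>, \<open>r\<^sub>k = \<alpha>~\<^sub>k / \<alpha>\<^sub>k\<close> (which tends to \<open>\<gamma>\<close>) and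
  \<open>z\<^sub>k = \<alpha>\<^sub>k x\<^sub>k + (1 - \<alpha>\<^sub>k) y\<^sub>k\<close>. Once \<open>\<alpha>\<^sub>k \<ge> 1\<close>, convexity at \<open>x\<^sub>k\<close> towards \<open>y\<^sub>k\<close> and \<open>x\<^sup>*\<close>,
  together with the decrease of \<open>f\<close> along the gradient step \<open>y\<^sub>k\<^sub>+\<^sub>1\<close>, bounds
  \<open>2 r\<^sub>k \<alpha>\<^sub>k\<^sup>2 s (f(y\<^sub>k\<^sub>+\<^sub>1) - f\<^sup>*) + \<parallel>z\<^sub>k\<^sub>+\<^sub>1 - x\<^sup>*\<parallel>\<^sup>2 + e r\<^sub>k \<alpha>\<^sub>k\<^sup>2 s\<^sup>2 \<parallel>g\<^sub>k\<parallel>\<^sup>2\<close> by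
  \<open>2 r\<^sub>k \<alpha>\<^sub>k (\<alpha>\<^sub>k - 1) s (f(y\<^sub>k) - f\<^sup>*) + \<parallel>z\<^sub>k - x\<^sup>*\<parallel>\<^sup>2\<close>, with \<open>e > 0\<close> because \<open>2\<beta> > \<gamma>\<close>. Since
  \<open>\<alpha>\<^sub>k (\<alpha>\<^sub>k - 1) \<le> \<alpha>\<^sub>k\<^sub>-\<^sub>1\<^sup>2\<close>, this telescopes when \<open>r\<close> is non-increasing; when \<open>r\<close> is
  non-decreasing it telescopes after division by \<open>r\<^sub>k\<close>. The finitely many steps before the
  asymptotic regime enlarge distances to \<open>x\<^sup>*\<close> by at most a constant factor, because
  \<open>s \<parallel>\<nabla>f(x)\<parallel> \<le> s L \<parallel>x - x\<^sup>*\<parallel>\<close> and \<open>s L\<close> is bounded. Finally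
  \<open>f(x\<^sub>k) \<le> f(y\<^sub>k\<^sub>+\<^sub>1) + \<beta>\<^sub>k s \<parallel>g\<^sub>k\<parallel>\<^sup>2\<close> passes from \<open>y\<close> to \<open>x\<close>.
\<close>

section \<open>Smooth convex functions on \<open>\<real>\<^sup>n\<close>\<close>

lemma Rn_closed [intro]:
  "x \<in> Rn n \<Longrightarrow> y \<in> Rn n \<Longrightarrow> x + y \<in> Rn n"
  "x \<in> Rn n \<Longrightarrow> y \<in> Rn n \<Longrightarrow> x - y \<in> Rn n"
  "x \<in> Rn n \<Longrightarrow> c *\<^sub>R x \<in> Rn n"
  using subspace_Rn by (auto intro: subspace_add subspace_diff subspace_scale)

lemma F1_has_gradient:
  assumes "f \<in> F1 n L" "x \<in> Rn n"
  shows "has_gradient n f x (grad n f x)"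
  using assms grad_eq unfolding F1_def by fastforce

lemma F1_grad_in_Rn [intro]: "f \<in> F1 n L \<Longrightarrow> x \<in> Rn n \<Longrightarrow> grad n f x \<in> Rn n"
  using F1_has_gradient unfolding has_gradient_def by blast

lemma F1_grad_lipschitz:
  "f \<in> F1 n L \<Longrightarrow> x \<in> Rn n \<Longrightarrow> y \<in> Rn n \<Longrightarrow> norm (grad n f y - grad n f x) \<le> L * norm (y - x)"
  unfolding F1_def by blast

text \<open>The line through \<open>x\<close> and \<open>y\<close> stays inside \<open>Rn n\<close>,
  so along it the derivative relative to \<open>Rn n\<close> is an ordinary one and the one-variable
  tangent inequality applies.\<close>

lemma F1_above_tangent:
  assumes f: "f \<in> F1 n L" and x: "x \<in> Rn n" and y: "y \<in> Rn n"
  shows "f x + inner (grad n f x) (y - x) \<le> f y"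
proof -
  define \<phi> where "\<phi> t = f (x + t *\<^sub>R (y - x))" for t :: real
  have line: "x + t *\<^sub>R (y - x) \<in> Rn n" for t
    using x y by blast
  have cvx: "convex_on (Rn n) f"
    using f unfolding F1_def by blast
  have "convex_on UNIV \<phi>"
  proof (rule convex_onI)
    fix t u v :: real assume t: "0 < t" "t < 1"
    have eq: "x + ((1 - t) *\<^sub>R u + t *\<^sub>R v) *\<^sub>R (y - x)
        = (1 - t) *\<^sub>R (x + u *\<^sub>R (y - x)) + t *\<^sub>R (x + v *\<^sub>R (y - x))"
      by (simp add: algebra_simps)
    show "\<phi> ((1 - t) *\<^sub>R u + t *\<^sub>R v) \<le> (1 - t) * \<phi> u + t * \<phi> v"
      unfolding \<phi>_def eq using t line by (intro convex_onD[OF cvx]) auto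
  qed simp
  moreover have "(\<phi> has_derivative (\<lambda>t. inner (grad n f x) (t *\<^sub>R (y - x)))) (at 0)"
  proof -
    have "((\<lambda>t. x + t *\<^sub>R (y - x)) has_derivative (\<lambda>t. t *\<^sub>R (y - x))) (at (0::real))"
      by (auto intro!: derivative_eq_intros)
    moreover have "(f has_derivative inner (grad n f x))
        (at (x + 0 *\<^sub>R (y - x)) within range (\<lambda>t. x + t *\<^sub>R (y - x)))"
      using F1_has_gradient[OF f x] line
      by (auto simp: has_gradient_def intro: has_derivative_subset)
    ultimately show ?thesis
      using has_derivative_in_compose[of "\<lambda>t. x + t *\<^sub>R (y - x)" "\<lambda>t. t *\<^sub>R (y - x)" 0 UNIV f
          "inner (grad n f x)"]
      by (simp add: \<phi>_def[abs_def])
  qed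
  then have "(\<phi> has_field_derivative inner (grad n f x) (y - x)) (at 0 within UNIV)"
    by (simp add: has_field_derivative_def mult.commute[of _ "inner (grad n f x) (y - x)"])
  ultimately have "inner (grad n f x) (y - x) * (1 - 0) \<le> \<phi> 1 - \<phi> 0"
    by (intro convex_on_imp_above_tangent[where A = UNIV]) auto
  then show ?thesis
    by (simp add: \<phi>_def)
qed

text \<open>The constant is \<open>L\<close> rather than the optimal \<open>L / 2\<close>; in exchange, two tangent inequalities
  suffice for the proof.\<close>

lemma F1_descent:
  assumes f: "f \<in> F1 n L" and x: "x \<in> Rn n" and y: "y \<in> Rn n"
  shows "f y \<le> f x + inner (grad n f x) (y - x) + L * (norm (y - x))\<^sup>2"
proof -
  have "f y \<le> f x + inner (grad n f y) (y - x)"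
    using F1_above_tangent[OF f y x] by (simp add: inner_diff_right)
  also have "inner (grad n f y) (y - x)
      = inner (grad n f x) (y - x) + inner (grad n f y - grad n f x) (y - x)"
    by (simp add: inner_diff_left)
  also have "inner (grad n f y - grad n f x) (y - x)
      \<le> norm (grad n f y - grad n f x) * norm (y - x)"
    by (rule norm_cauchy_schwarz)
  also have "\<dots> \<le> L * norm (y - x) * norm (y - x)"
    by (intro mult_right_mono F1_grad_lipschitz[OF f x y]) simp
  finally show ?thesis
    by (simp add: power2_eq_square algebra_simps)
qed

lemma F1_gradient_step:
  assumes "f \<in> F1 n L" "x \<in> Rn n"
  shows "f (x - t *\<^sub>R grad n f x) \<le> f x - t * (1 - L * t) * (norm (grad n f x))\<^sup>2"
proof -
  have "f (x - t *\<^sub>R grad n f x)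
      \<le> f x - t * inner (grad n f x) (grad n f x) + L * (\<bar>t\<bar> * norm (grad n f x))\<^sup>2"
    using F1_descent[OF assms, of "x - t *\<^sub>R grad n f x"] assms by auto
  then show ?thesis
    by (simp add: power2_norm_eq_inner[symmetric] power_mult_distrib power2_eq_square[of t]
        algebra_simps)
qed

lemma grad_minimizer:
  assumes "L > 0" "f \<in> F1 n L" "minimizer n f xs"
  shows "grad n f xs = 0"
proof -
  have xs: "xs \<in> Rn n" using assms(3) by (simp add: minimizer_def)
  \<comment> \<open>The guaranteed decrease factor \<open>t * (1 - L * t)\<close> is largest at
    \<open>t = 1 / (2 * L)\<close>, with value \<open>1 / (4 * L)\<close>; a nonzero gradient would
    contradict minimality.\<close>
  then have "f xs \<le> f (xs - (1 / (2 * L)) *\<^sub>R grad n f xs)"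
    using assms unfolding minimizer_def by blast
  also have "\<dots> \<le> f xs - 1 / (4 * L) * (norm (grad n f xs))\<^sup>2"
    using F1_gradient_step[OF assms(2) xs, of "1 / (2 * L)"] assms(1) by simp
  finally show ?thesis
    using assms(1) by (simp add: field_simps)
qed

text \<open>This and \<open>gap_le_minimizer\<close> let distances to \<open>xs\<close> bound
  gradients and values up to the index where the energy inequality takes over.\<close>

lemma norm_grad_le_minimizer:
  assumes "L > 0" "f \<in> F1 n L" "minimizer n f xs" "x \<in> Rn n"
  shows "norm (grad n f x) \<le> L * norm (x - xs)"
  using F1_grad_lipschitz[of f n L xs x] grad_minimizer[OF assms(1-3)] assms
  by (simp add: minimizer_def)

lemma gap_le_minimizer:
  assumes "L > 0" "f \<in> F1 n L" "minimizer n f xs" "x \<in> Rn n"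
  shows "f x - f xs \<le> L * (norm (x - xs))\<^sup>2"
  using F1_descent[of f n L xs x] grad_minimizer[OF assms(1-3)] assms
  by (simp add: minimizer_def)

section \<open>One step of the algorithm\<close>

text \<open>The decrease at \<open>y'\<close> has to pay for the term
  \<open>(r * a * s)\<^sup>2 * (norm g)\<^sup>2\<close> that comes from expanding the square;
  \<open>e\<close> is a lower bound for the coefficient that remains.\<close>

lemma energy_step:
  fixes x y z xs g :: "'a::real_inner"
  assumes z: "z = a *\<^sub>R x + (1 - a) *\<^sub>R y" and z': "z' = z - (r * a * s) *\<^sub>R g"
    and "a \<ge> 1" "s \<ge> 0" "r \<ge> 0"
    and xs: "fx - fs \<le> inner g (x - xs)" and xy: "fx - fy \<le> inner g (x - y)"
    and y': "fy' \<le> fx - b * s * (1 - L * (b * s)) * (norm g)\<^sup>2"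
    and e: "e \<le> 2 * b * (1 - L * (b * s)) - r"
  shows "2 * r * a\<^sup>2 * s * (fy' - fs) + e * r * a\<^sup>2 * (s\<^sup>2 * (norm g)\<^sup>2) + (norm (z' - xs))\<^sup>2
    \<le> 2 * r * (a * (a - 1)) * s * (fy - fs) + (norm (z - xs))\<^sup>2"
proof -
  let ?i = "inner g (z - xs)" and ?G = "(norm g)\<^sup>2"
  have D: "(norm (z' - xs))\<^sup>2 = (norm (z - xs))\<^sup>2 - 2 * (r * a * s) * ?i + (r * a * s)\<^sup>2 * ?G"
    unfolding z' power2_norm_eq_inner
    by (simp add: inner_diff_left inner_diff_right inner_commute power2_eq_square algebra_simps)
  \<comment> \<open>This splitting uses each convexity inequality once; \<open>a \<ge> 1\<close>
    makes the weight of the second one nonnegative.\<close>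
  have "z - xs = (x - xs) + (a - 1) *\<^sub>R (x - y)"
    unfolding z by (simp add: algebra_simps)
  then have "?i = inner g (x - xs) + (a - 1) * inner g (x - y)"
    by (simp only: inner_add_right inner_scaleR_right)
  moreover have "(a - 1) * (fx - fy) \<le> (a - 1) * inner g (x - y)"
    using xy \<open>a \<ge> 1\<close> by (intro mult_left_mono) auto
  ultimately have "(fx - fs) + (a - 1) * (fx - fy) \<le> ?i"
    using xs by linarith
  moreover have "a * (fy' + b * s * (1 - L * (b * s)) * ?G) \<le> a * fx"
    using y' \<open>a \<ge> 1\<close> by (intro mult_left_mono) auto
  ultimately have "a * (fy' - fs) + a * (b * s * (1 - L * (b * s)) * ?G) - (a - 1) * (fy - fs) \<le> ?i"
    by (simp add: algebra_simps)
  then have "2 * (r * a * s) * (a * (fy' - fs) + a * (b * s * (1 - L * (b * s)) * ?G)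
      - (a - 1) * (fy - fs)) \<le> 2 * (r * a * s) * ?i"
    using assms by (intro mult_left_mono) auto
  moreover have "e * (r * a\<^sup>2 * (s\<^sup>2 * ?G)) \<le> (2 * b * (1 - L * (b * s)) - r) * (r * a\<^sup>2 * (s\<^sup>2 * ?G))"
    using e assms by (intro mult_right_mono) auto
  ultimately show ?thesis
    unfolding D by (simp add: algebra_simps power2_eq_square)
qed

text \<open>Here \<open>w\<close> multiplies the energy inequality and \<open>p\<close> stands for
  \<open>w\<close> times the ratio \<open>r\<close>, so that \<open>w = 1\<close> and
  \<open>w = 1 / r\<close> cover the two monotone cases at once.\<close>

lemma weighted_telescope:
  fixes p w a d D G :: "nat \<Rightarrow> real"
  assumes step: "\<And>k. k \<ge> N \<Longrightarrow> 2 * p k * (a k)\<^sup>2 * d (Suc k) + e * p k * (a k)\<^sup>2 * G k + w k * D (Suc k)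
      \<le> 2 * p k * (a k * (a k - 1)) * d k + w k * D k"
    and p: "\<And>k. k \<ge> N \<Longrightarrow> 0 \<le> p (Suc k) \<and> p (Suc k) \<le> p k"
    and w: "\<And>k. k \<ge> N \<Longrightarrow> w (Suc k) \<le> w k"
    and a: "\<And>k. a (Suc k) * (a (Suc k) - 1) \<le> (a k)\<^sup>2"
    and d: "\<And>k. 0 \<le> d k" and D: "\<And>k. 0 \<le> D k"
    and "k \<ge> N"
  shows "2 * p k * (a k)\<^sup>2 * d (Suc k) + w k * D (Suc k) + (\<Sum>i=N..k. e * p i * (a i)\<^sup>2 * G i)
    \<le> 2 * p N * (a N * (a N - 1)) * d N + w N * D N"
  using \<open>k \<ge> N\<close>
proof (induction k rule: dec_induct)
  case base
  then show ?case using step[of N] by simp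
next
  case (step k)
  \<comment> \<open>The coefficient of \<open>d (Suc k)\<close> on the right of the next step is
    absorbed by its coefficient on the left of the current one.\<close>
  have "p (Suc k) * (a (Suc k) * (a (Suc k) - 1)) \<le> p (Suc k) * (a k)\<^sup>2"
    using p[OF step.hyps(1)] a by (intro mult_left_mono) auto
  also have "\<dots> \<le> p k * (a k)\<^sup>2"
    using p[OF step.hyps(1)] by (intro mult_right_mono) auto
  finally have "2 * (p (Suc k) * (a (Suc k) * (a (Suc k) - 1))) * d (Suc k) \<le> 2 * (p k * (a k)\<^sup>2) * d (Suc k)"
    using d by (intro mult_right_mono mult_left_mono) auto
  moreover have "w (Suc k) * D (Suc k) \<le> w k * D (Suc k)"
    using w[OF step.hyps(1)] D by (intro mult_right_mono) auto
  ultimately show ?case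
    using step.IH assms(1)[of "Suc k"] step.hyps by (simp add: mult.assoc)
qed

lemma cube_le_sum_squares:
  assumes "N \<ge> 1" "k \<ge> 2 * N"
  shows "(real k + 1) ^ 3 \<le> 28 * (\<Sum>i=N..k. (real i)\<^sup>2)"
proof -
  have "real j ^ 3 - real N ^ 3 \<le> 3 * (\<Sum>i=N..j. (real i)\<^sup>2)" if "j \<ge> N" for j
    using that
  proof (induction j rule: dec_induct)
    case (step j)
    then show ?case by (simp add: power3_eq_cube power2_eq_square algebra_simps)
  qed simp
  then have *: "real k ^ 3 - real N ^ 3 \<le> 3 * (\<Sum>i=N..k. (real i)\<^sup>2)"
    using assms by simp
  \<comment> \<open>From \<open>N^3 \<le> k^3 / 8\<close> and \<open>(k + 1)^3 \<le> 8 * k^3\<close>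
    the factor is 8 * (8/7) * 3 = 192/7, rounded up to 28.\<close>
  have "(2 * real N) ^ 3 \<le> real k ^ 3"
    using assms by (intro power_mono) auto
  moreover have "(real k + 1) ^ 3 \<le> (2 * real k) ^ 3"
    using assms by (intro power_mono) auto
  moreover have "0 \<le> (\<Sum>i=N..k. (real i)\<^sup>2)"
    by (intro sum_nonneg) simp
  ultimately show ?thesis
    using * by (simp add: power_mult_distrib)
qed

section \<open>The iterates\<close>

lemma algB_Suc:
  "snd (algB \<alpha> \<beta> \<gamma> s G x0 (Suc k)) = fst (algB \<alpha> \<beta> \<gamma> s G x0 k) - (\<beta> k * s) *\<^sub>R G (fst (algB \<alpha> \<beta> \<gamma> s G x0 k))"
  "fst (algB \<alpha> \<beta> \<gamma> s G x0 (Suc k)) = fst (algB \<alpha> \<beta> \<gamma> s G x0 k)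
    - (\<gamma> k * s) *\<^sub>R G (fst (algB \<alpha> \<beta> \<gamma> s G x0 k))
    + ((\<alpha> k - 1) / \<alpha> (Suc k)) *\<^sub>R (snd (algB \<alpha> \<beta> \<gamma> s G x0 (Suc k)) - snd (algB \<alpha> \<beta> \<gamma> s G x0 k))"
  by (simp_all add: case_prod_beta Let_def)

declare algB.simps(2) [simp del]

lemma algB_in_Rn:
  assumes "f \<in> F1 n L" "x0 \<in> Rn n"
  shows "fst (algB \<alpha> \<beta> \<gamma> s (grad n f) x0 k) \<in> Rn n \<and> snd (algB \<alpha> \<beta> \<gamma> s (grad n f) x0 k) \<in> Rn n"
proof (induction k)
  case 0
  then show ?case using assms by simp
next
  case (Suc k)
  then have "snd (algB \<alpha> \<beta> \<gamma> s (grad n f) x0 (Suc k)) \<in> Rn n"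
    unfolding algB_Suc using assms by blast
  then show ?case
    using Suc assms by (auto simp only: algB_Suc(2) intro!: Rn_closed F1_grad_in_Rn)
qed

text \<open>The sequence \<open>z\<^sub>k\<close>, recovered from the pair because
  \<open>algB\<close> does not carry it.\<close>

definition auxB :: "(nat \<Rightarrow> real) \<Rightarrow> (nat \<Rightarrow> real) \<Rightarrow> (nat \<Rightarrow> real) \<Rightarrow> real
    \<Rightarrow> (fsseq \<Rightarrow> fsseq) \<Rightarrow> fsseq \<Rightarrow> nat \<Rightarrow> fsseq"
  where "auxB \<alpha> \<beta> \<gamma> s G x0 k =
    \<alpha> k *\<^sub>R fst (algB \<alpha> \<beta> \<gamma> s G x0 k) + (1 - \<alpha> k) *\<^sub>R snd (algB \<alpha> \<beta> \<gamma> s G x0 k)"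

text \<open>Multiplying by \<open>\<alpha> (Suc k)\<close> clears the momentum denominator. The new
  point \<open>y'\<close> then has coefficient \<open>\<alpha> k - \<alpha> (Suc k)\<close>, and
  collecting the gradient terms gives exactly \<open>alpha_tilde\<close>.\<close>

lemma auxB_Suc:
  assumes "\<alpha> (Suc k) \<noteq> 0"
  shows "auxB \<alpha> \<beta> \<gamma> s G x0 (Suc k) = auxB \<alpha> \<beta> \<gamma> s G x0 k
    - (alpha_tilde \<alpha> \<beta> \<gamma> k * s) *\<^sub>R G (fst (algB \<alpha> \<beta> \<gamma> s G x0 k))"
proof -
  define x y where "x = fst (algB \<alpha> \<beta> \<gamma> s G x0 k)" and "y = snd (algB \<alpha> \<beta> \<gamma> s G x0 k)"
  define y' where "y' = x - (\<beta> k * s) *\<^sub>R G x"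
  have "auxB \<alpha> \<beta> \<gamma> s G x0 (Suc k)
      = \<alpha> (Suc k) *\<^sub>R (x - (\<gamma> k * s) *\<^sub>R G x + ((\<alpha> k - 1) / \<alpha> (Suc k)) *\<^sub>R (y' - y))
        + (1 - \<alpha> (Suc k)) *\<^sub>R y'"
    unfolding auxB_def algB_Suc x_def y_def y'_def by simp
  also have "\<dots> = \<alpha> (Suc k) *\<^sub>R (x - (\<gamma> k * s) *\<^sub>R G x) + (\<alpha> k - 1) *\<^sub>R (y' - y)
      + (1 - \<alpha> (Suc k)) *\<^sub>R y'"
    using assms by (simp add: scaleR_add_right)
  also have "\<dots> = \<alpha> k *\<^sub>R x + (1 - \<alpha> k) *\<^sub>R y - (alpha_tilde \<alpha> \<beta> \<gamma> k * s) *\<^sub>R G x"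
    unfolding y'_def alpha_tilde_def by (simp add: algebra_simps)
  finally show ?thesis
    by (simp add: auxB_def x_def y_def)
qed

text \<open>The order of quantifiers is the point: \<open>M\<close> depends on \<open>k\<close>,
  \<open>C0\<close> and the three sequences, but not on the dimension, \<open>f\<close>,
  \<open>L\<close> or \<open>s\<close>. No uniformity in \<open>k\<close> is claimed.\<close>

lemma algB_bounded:
  assumes "C0 > 0"
  shows "\<exists>M\<ge>0. \<forall>n L f xs x0 s. L > 0 \<longrightarrow> f \<in> F1 n L \<longrightarrow> minimizer n f xs \<longrightarrow> x0 \<in> Rn n
    \<longrightarrow> 0 < s \<longrightarrow> s \<le> C0 / L \<longrightarrow>
      norm (fst (algB \<alpha> \<beta> \<gamma> s (grad n f) x0 k) - xs) \<le> M * norm (x0 - xs) \<and>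
      norm (snd (algB \<alpha> \<beta> \<gamma> s (grad n f) x0 k) - xs) \<le> M * norm (x0 - xs)"
proof (induction k)
  case 0
  show ?case by (rule exI[of _ 1]) simp
next
  case (Suc k)
  then obtain M where M: "M \<ge> 0" and bound:
    "\<And>n L f xs x0 s. \<lbrakk>L > 0; f \<in> F1 n L; minimizer n f xs; x0 \<in> Rn n; 0 < s; s \<le> C0 / L\<rbrakk> \<Longrightarrow>
      norm (fst (algB \<alpha> \<beta> \<gamma> s (grad n f) x0 k) - xs) \<le> M * norm (x0 - xs) \<and>
      norm (snd (algB \<alpha> \<beta> \<gamma> s (grad n f) x0 k) - xs) \<le> M * norm (x0 - xs)"
    by metis
  define \<sigma> where "\<sigma> = (\<alpha> k - 1) / \<alpha> (Suc k)"
  define M1 where "M1 = M + \<bar>\<beta> k\<bar> * (C0 * M)"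
  define M2 where "M2 = M + \<bar>\<gamma> k\<bar> * (C0 * M) + \<bar>\<sigma>\<bar> * (M1 + M)"
  have nonneg: "M1 \<ge> 0" "M2 \<ge> 0"
    using M assms by (auto simp: M1_def M2_def)
  show ?case
  proof (intro exI[of _ "max M1 M2"] conjI allI impI)
    show "max M1 M2 \<ge> 0" using nonneg by simp
    fix n L f xs x0 s
    assume H: "L > 0" "f \<in> F1 n L" "minimizer n f xs" "x0 \<in> Rn n" "0 < s" "s \<le> C0 / L"
    define R where "R = norm (x0 - xs)"
    define x y where "x = fst (algB \<alpha> \<beta> \<gamma> s (grad n f) x0 k)"
      and "y = snd (algB \<alpha> \<beta> \<gamma> s (grad n f) x0 k)"
    define x' y' where "x' = fst (algB \<alpha> \<beta> \<gamma> s (grad n f) x0 (Suc k))"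
      and "y' = snd (algB \<alpha> \<beta> \<gamma> s (grad n f) x0 (Suc k))"
    have xR: "x \<in> Rn n" using algB_in_Rn[OF H(2,4)] by (simp add: x_def)
    have x: "norm (x - xs) \<le> M * R" and y: "norm (y - xs) \<le> M * R"
      using bound[OF H] by (auto simp: x_def y_def R_def)
    have "s * norm (grad n f x) \<le> s * (L * norm (x - xs))"
      using norm_grad_le_minimizer[OF H(1-3) xR] H by (intro mult_left_mono) auto
    also have "\<dots> \<le> C0 * norm (x - xs)"
      using H mult_right_mono[of "s * L" C0 "norm (x - xs)"] by (simp add: field_simps)
    also have "\<dots> \<le> C0 * (M * R)"
      using x assms by (intro mult_left_mono) auto
    finally have g: "norm ((t * s) *\<^sub>R grad n f x) \<le> \<bar>t\<bar> * (C0 * (M * R))" for t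
      using H mult_left_mono[of "s * norm (grad n f x)" "C0 * (M * R)" "\<bar>t\<bar>"]
      by (simp add: abs_mult mult.assoc)
    have "norm (y' - xs) = norm ((x - xs) - (\<beta> k * s) *\<^sub>R grad n f x)"
      unfolding y'_def x_def algB_Suc by (simp add: algebra_simps)
    then have "norm (y' - xs) \<le> M * R + \<bar>\<beta> k\<bar> * (C0 * (M * R))"
      using norm_triangle_ineq4[of "x - xs" "(\<beta> k * s) *\<^sub>R grad n f x"] x g[of "\<beta> k"] by linarith
    then have y': "norm (y' - xs) \<le> M1 * R"
      by (simp add: M1_def algebra_simps)
    have "x' - xs = ((x - xs) - (\<gamma> k * s) *\<^sub>R grad n f x) + \<sigma> *\<^sub>R ((y' - xs) - (y - xs))"
      unfolding x'_def y'_def x_def y_def \<sigma>_def algB_Suc(2) by simp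
    then have "norm (x' - xs) \<le> norm ((x - xs) - (\<gamma> k * s) *\<^sub>R grad n f x)
        + norm (\<sigma> *\<^sub>R ((y' - xs) - (y - xs)))"
      by (simp only: norm_triangle_ineq)
    also have "norm ((x - xs) - (\<gamma> k * s) *\<^sub>R grad n f x) \<le> M * R + \<bar>\<gamma> k\<bar> * (C0 * (M * R))"
      using norm_triangle_ineq4[of "x - xs" "(\<gamma> k * s) *\<^sub>R grad n f x"] x g[of "\<gamma> k"] by simp
    also have "norm (\<sigma> *\<^sub>R ((y' - xs) - (y - xs))) \<le> \<bar>\<sigma>\<bar> * (M1 * R + M * R)"
      using norm_triangle_ineq4[of "y' - xs" "y - xs"] y y'
      by (simp only: norm_scaleR) (intro mult_left_mono, auto)
    finally have x': "norm (x' - xs) \<le> M2 * R"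
      by (simp add: M2_def algebra_simps)
    have "M1 * R \<le> max M1 M2 * R" "M2 * R \<le> max M1 M2 * R"
      by (auto intro!: mult_right_mono simp: R_def)
    then show "norm (fst (algB \<alpha> \<beta> \<gamma> s (grad n f) x0 (Suc k)) - xs) \<le> max M1 M2 * norm (x0 - xs)"
      and "norm (snd (algB \<alpha> \<beta> \<gamma> s (grad n f) x0 (Suc k)) - xs) \<le> max M1 M2 * norm (x0 - xs)"
      using x' y' by (auto simp: x'_def y'_def R_def)
  qed
qed

lemma alpha_tilde_ratio_tendsto:
  assumes "\<beta> \<longlonglongrightarrow> b" "\<gamma> \<longlonglongrightarrow> c" "\<And>k. \<alpha> k > 0" "(\<lambda>k. \<alpha> (Suc k) / \<alpha> k) \<longlonglongrightarrow> 1"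
  shows "(\<lambda>k. alpha_tilde \<alpha> \<beta> \<gamma> k / \<alpha> k) \<longlonglongrightarrow> c"
proof -
  have "(\<lambda>k. \<beta> k + (\<gamma> k - \<beta> k) * (\<alpha> (Suc k) / \<alpha> k)) \<longlonglongrightarrow> b + (c - b) * 1"
    by (intro tendsto_intros assms)
  moreover have "alpha_tilde \<alpha> \<beta> \<gamma> k / \<alpha> k = \<beta> k + (\<gamma> k - \<beta> k) * (\<alpha> (Suc k) / \<alpha> k)" for k
    using assms(3)[of k] by (simp add: alpha_tilde_def field_simps)
  ultimately show ?thesis by simp
qed

section \<open>Convergence rates\<close>

theorem theorem4:
  fixes \<alpha> \<beta> \<gamma> :: "nat \<Rightarrow> real" and \<beta>lim \<gamma>lim :: real
  assumes "\<beta> \<longlonglongrightarrow> \<beta>lim" and "\<gamma> \<longlonglongrightarrow> \<gamma>lim"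
    and "\<beta>lim > \<gamma>lim / 2" and "\<gamma>lim / 2 > 0"
    and "\<And>k. \<alpha> k > 0"
    and "\<exists>c>0. \<exists>k0\<ge>1. \<forall>k\<ge>k0. \<alpha> k \<ge> c * real k"
    and "(\<lambda>k. \<alpha> (Suc k) / \<alpha> k) \<longlonglongrightarrow> 1"
    and "\<And>k. \<alpha> (Suc k) * (\<alpha> (Suc k) - 1) \<le> (\<alpha> k)\<^sup>2"
    and "decseq (\<lambda>k. alpha_tilde \<alpha> \<beta> \<gamma> k / \<alpha> k) \<or> incseq (\<lambda>k. alpha_tilde \<alpha> \<beta> \<gamma> k / \<alpha> k)"
  shows "\<exists>C>0. \<exists>C0>0. \<exists>K\<ge>1. \<forall>n. \<forall>L>0. \<forall>f\<in>F1 n L. \<forall>xs. minimizer n f xs \<longrightarrow>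
    (\<forall>x0\<in>Rn n. \<forall>s. 0 < s \<and> s \<le> C0 / L \<longrightarrow> (\<forall>k\<ge>K.
      f (iterB \<alpha> \<beta> \<gamma> s n f x0 k) - f xs \<le> C * ((norm (x0 - xs))\<^sup>2 / (s * (real k)\<^sup>2)) \<and>
      (MIN i\<in>{0..k}. (norm (grad n f (iterB \<alpha> \<beta> \<gamma> s n f x0 i)))\<^sup>2)
        \<le> C * ((norm (x0 - xs))\<^sup>2 / (s\<^sup>2 * (real k + 1) ^ 3))))"
proof -

  \<comment> \<open>The asymptotic regime and its constants\<close>
  define r where "r k = alpha_tilde \<alpha> \<beta> \<gamma> k / \<alpha> k" for k
  have r_lim: "r \<longlonglongrightarrow> \<gamma>lim"
    unfolding r_def[abs_def] by (rule alpha_tilde_ratio_tendsto[OF assms(1,2,5,7)])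
  obtain c k0 where c: "c > 0" and \<alpha>_ge: "\<And>k. k \<ge> k0 \<Longrightarrow> \<alpha> k \<ge> c * real k"
    using assms(6) by blast
  obtain B where B: "B > 0" and \<beta>_le: "\<And>k. \<bar>\<beta> k\<bar> \<le> B"
    using convergent_imp_Bseq[OF convergentI[OF assms(1)]] by (auto elim!: BseqE)
  \<comment> \<open>The limit of \<open>2 * \<beta> k - r k\<close> is \<open>4 * e\<close>, so
    eventually it exceeds \<open>2 * e\<close>. The choice of \<open>C0\<close> ensures
    \<open>2 * (\<beta> k)\<^sup>2 * s * L \<le> e\<close>, which leaves a margin
    \<open>e\<close>.\<close>
  define e where "e = (2 * \<beta>lim - \<gamma>lim) / 4"
  have e: "e > 0" using assms(3) by (simp add: e_def)
  define C0 where "C0 = e / (2 * B\<^sup>2)"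
  have C0: "C0 > 0" using e B by (simp add: C0_def)
  have "(\<lambda>k. 2 * \<beta> k - r k) \<longlonglongrightarrow> 2 * \<beta>lim - \<gamma>lim"
    by (intro tendsto_intros assms r_lim)
  then have "\<forall>\<^sub>F k in sequentially. 2 * \<beta> k - r k > 2 * e"
    by (rule order_tendstoD) (use e in \<open>simp add: e_def\<close>)
  moreover have "\<forall>\<^sub>F k in sequentially. r k > \<gamma>lim / 2"
    using r_lim by (rule order_tendstoD) (use assms(4) in simp)
  \<comment> \<open>Beyond \<open>1 / c\<close> the linear lower bound \<open>c * k\<close> is at
    least 1, as \<open>energy_step\<close> requires of \<open>\<alpha> k\<close>.\<close>
  moreover have "\<forall>\<^sub>F k in sequentially. k \<ge> max 1 (max k0 (nat \<lceil>1 / c\<rceil>))"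
    by (rule eventually_ge_at_top)
  ultimately have "\<forall>\<^sub>F k in sequentially. 2 * \<beta> k - r k > 2 * e \<and> r k > \<gamma>lim / 2
      \<and> k \<ge> max 1 (max k0 (nat \<lceil>1 / c\<rceil>))"
    by eventually_elim simp
  then obtain N where N: "\<And>k. k \<ge> N \<Longrightarrow> 2 * \<beta> k - r k > 2 * e \<and> r k > \<gamma>lim / 2
      \<and> k \<ge> max 1 (max k0 (nat \<lceil>1 / c\<rceil>))"
    by (auto simp: eventually_sequentially)
  have N1: "N \<ge> 1" and r_gt: "\<And>k. k \<ge> N \<Longrightarrow> r k > \<gamma>lim / 2"
    and br: "\<And>k. k \<ge> N \<Longrightarrow> 2 * \<beta> k - r k > 2 * e"
    and \<alpha>N: "\<And>k. k \<ge> N \<Longrightarrow> \<alpha> k \<ge> c * real k"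
    using N \<alpha>_ge by force+
  have r_pos: "\<And>k. k \<ge> N \<Longrightarrow> r k > 0"
    using r_gt assms(4) by (meson less_trans)
  have \<alpha>1: "\<alpha> k \<ge> 1" if "k \<ge> N" for k
  proof -
    have "real k \<ge> 1 / c" using N[OF that] by (simp add: nat_le_iff ceiling_le_iff)
    then show ?thesis using \<alpha>N[OF that] c by (simp add: field_simps)
  qed

  \<comment> \<open>Weights for the two monotone cases\<close>
  define P where "P = min 1 (\<gamma>lim / 2)"
  have P: "P > 0" using assms(4) by (simp add: P_def)
  \<comment> \<open>The witnesses are \<open>w = 1\<close> for non-increasing \<open>r\<close> and
    \<open>w = 1 / r\<close> otherwise. The products \<open>w k * r k\<close> are then
    \<open>r k\<close> or 1, hence at least \<open>P\<close>.\<close>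
  obtain w where w_pos: "\<And>k. k \<ge> N \<Longrightarrow> w k > 0"
    and w_dec: "\<And>k. k \<ge> N \<Longrightarrow> w (Suc k) \<le> w k"
    and wr_dec: "\<And>k. k \<ge> N \<Longrightarrow> w (Suc k) * r (Suc k) \<le> w k * r k"
    and wr_ge: "\<And>k. k \<ge> N \<Longrightarrow> P \<le> w k * r k"
  proof (cases "decseq r")
    case True
    have "P \<le> r k" if "k \<ge> N" for k
      using r_gt[OF that] by (simp add: P_def)
    then show ?thesis
      using True by (intro that[of "\<lambda>_. 1"]) (auto dest: decseq_SucD)
  next
    case False
    then have "incseq r" using assms(9) by (simp add: r_def[abs_def])
    then show ?thesis
      using r_pos by (intro that[of "\<lambda>k. 1 / r k"])
        (auto simp: P_def less_imp_neq[THEN not_sym] dest: incseq_SucD intro!: divide_left_mono mult_pos_pos)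
  qed

  \<comment> \<open>Bounds at the starting index and the final constants\<close>
  obtain M where M: "M \<ge> 0" and bound:
    "\<And>n L f xs x0 s. \<lbrakk>L > 0; f \<in> F1 n L; minimizer n f xs; x0 \<in> Rn n; 0 < s; s \<le> C0 / L\<rbrakk> \<Longrightarrow>
      norm (fst (algB \<alpha> \<beta> \<gamma> s (grad n f) x0 N) - xs) \<le> M * norm (x0 - xs) \<and>
      norm (snd (algB \<alpha> \<beta> \<gamma> s (grad n f) x0 N) - xs) \<le> M * norm (x0 - xs)"
    using algB_bounded[OF C0, of \<alpha> \<beta> \<gamma> N] by metis
  \<comment> \<open>The energy at \<open>N\<close> in units of the squared initial distance: the
    first summand bounds the gap at \<open>y N\<close>, the second the distance of
    \<open>z N\<close> to \<open>xs\<close>.\<close>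
  define C1 where "C1 = 2 * (w N * r N) * (\<alpha> N * (\<alpha> N - 1)) * (C0 * M\<^sup>2)
      + w N * (\<alpha> N * M + (\<alpha> N - 1) * M)\<^sup>2"
  have C1: "C1 \<ge> 0"
    using \<alpha>1[of N] w_pos[of N] r_pos[of N] C0 by (simp add: C1_def)
  \<comment> \<open>Adding 1 only secures positivity.\<close>
  define Q where "Q = (C1 + 1) / (P * c\<^sup>2)"
  have Q: "Q > 0" using C1 P c by (simp add: Q_def)
  \<comment> \<open>The summands serve, in order, the gap at \<open>y (Suc k)\<close>, the passage
    from there to \<open>x k\<close>, and the gradient rate.\<close>
  define C where "C = Q * (1 + B / e + 28 / e)"
  have C: "C > 0" using Q B e by (simp add: C_def add_pos_pos)

  \<comment> \<open>The energy estimate for a fixed problem\<close>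
  have rates: "f (iterB \<alpha> \<beta> \<gamma> s n f x0 k) - f xs \<le> C * ((norm (x0 - xs))\<^sup>2 / (s * (real k)\<^sup>2)) \<and>
      (MIN i\<in>{0..k}. (norm (grad n f (iterB \<alpha> \<beta> \<gamma> s n f x0 i)))\<^sup>2)
        \<le> C * ((norm (x0 - xs))\<^sup>2 / (s\<^sup>2 * (real k + 1) ^ 3))"
    if H: "L > 0" "f \<in> F1 n L" "minimizer n f xs" "x0 \<in> Rn n" "0 < s" "s \<le> C0 / L"
      and k: "k \<ge> 2 * N" for n L f xs x0 s k
  proof -
    define R where "R = norm (x0 - xs)"
    define x y z where "x k = fst (algB \<alpha> \<beta> \<gamma> s (grad n f) x0 k)"
      and "y k = snd (algB \<alpha> \<beta> \<gamma> s (grad n f) x0 k)"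
      and "z k = auxB \<alpha> \<beta> \<gamma> s (grad n f) x0 k" for k
    define g where "g k = grad n f (x k)" for k
    define G where "G k = s\<^sup>2 * (norm (g k))\<^sup>2" for k
    have xR: "x k \<in> Rn n" and yR: "y k \<in> Rn n" for k
      using algB_in_Rn[OF H(2,4)] by (auto simp: x_def y_def)
    have xsR: "xs \<in> Rn n" and min: "\<And>u. u \<in> Rn n \<Longrightarrow> f xs \<le> f u"
      using H(3) by (auto simp: minimizer_def)
    have sL: "s * L \<le> C0" using H by (simp add: field_simps)
    have y_Suc: "y (Suc k) = x k - (\<beta> k * s) *\<^sub>R g k" for k
      by (simp add: x_def y_def g_def algB_Suc)

    have step: "2 * (w k * r k) * (\<alpha> k)\<^sup>2 * (s * (f (y (Suc k)) - f xs)) + e * (w k * r k) * (\<alpha> k)\<^sup>2 * G k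
        + w k * (norm (z (Suc k) - xs))\<^sup>2
        \<le> 2 * (w k * r k) * (\<alpha> k * (\<alpha> k - 1)) * (s * (f (y k) - f xs)) + w k * (norm (z k - xs))\<^sup>2"
      if "k \<ge> N" for k
    proof -
      have "2 * r k * (\<alpha> k)\<^sup>2 * s * (f (y (Suc k)) - f xs) + e * r k * (\<alpha> k)\<^sup>2 * (s\<^sup>2 * (norm (g k))\<^sup>2)
          + (norm (z (Suc k) - xs))\<^sup>2
          \<le> 2 * r k * (\<alpha> k * (\<alpha> k - 1)) * s * (f (y k) - f xs) + (norm (z k - xs))\<^sup>2"
      proof (rule energy_step[where x = "x k" and b = "\<beta> k" and L = L and fx = "f (x k)"])
        show "z k = \<alpha> k *\<^sub>R x k + (1 - \<alpha> k) *\<^sub>R y k"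
          by (simp add: z_def x_def y_def auxB_def)
        show "z (Suc k) = z k - (r k * \<alpha> k * s) *\<^sub>R g k"
          using auxB_Suc[of \<alpha> k \<beta> \<gamma> s "grad n f" x0] assms(5)[of k] assms(5)[of "Suc k"]
          by (simp add: z_def x_def g_def r_def)
        show "1 \<le> \<alpha> k" "0 \<le> s" "0 \<le> r k"
          using \<alpha>1[OF that] H r_pos[OF that] by auto
        show "f (x k) - f xs \<le> inner (g k) (x k - xs)"
          using F1_above_tangent[OF H(2) xR[of k] xsR] by (simp add: g_def inner_diff_right)
        show "f (x k) - f (y k) \<le> inner (g k) (x k - y k)"
          using F1_above_tangent[OF H(2) xR[of k] yR[of k]] by (simp add: g_def inner_diff_right)
        show "f (y (Suc k)) \<le> f (x k) - \<beta> k * s * (1 - L * (\<beta> k * s)) * (norm (g k))\<^sup>2"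
          using F1_gradient_step[OF H(2) xR[of k], of "\<beta> k * s"] by (simp add: y_Suc g_def)
        have "(\<beta> k)\<^sup>2 * (s * L) \<le> B\<^sup>2 * C0"
          using sL \<beta>_le[of k] B H by (intro mult_mono) (auto simp: abs_le_square_iff[symmetric])
        then have "2 * ((\<beta> k)\<^sup>2 * (s * L)) \<le> e"
          using B by (simp add: C0_def)
        then show "e \<le> 2 * \<beta> k * (1 - L * (\<beta> k * s)) - r k"
          using br[OF that] by (simp add: algebra_simps power2_eq_square)
      qed
      from mult_left_mono[OF this, of "w k"] w_pos[OF that] show ?thesis
        by (simp add: G_def algebra_simps)
    qed
    have energy: "2 * (w k * r k) * (\<alpha> k)\<^sup>2 * (s * (f (y (Suc k)) - f xs)) + w k * (norm (z (Suc k) - xs))\<^sup>2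
        + (\<Sum>i=N..k. e * (w i * r i) * (\<alpha> i)\<^sup>2 * G i)
        \<le> 2 * (w N * r N) * (\<alpha> N * (\<alpha> N - 1)) * (s * (f (y N) - f xs)) + w N * (norm (z N - xs))\<^sup>2"
    proof (rule weighted_telescope[where p = "\<lambda>k. w k * r k" and d = "\<lambda>k. s * (f (y k) - f xs)"
          and D = "\<lambda>k. (norm (z k - xs))\<^sup>2", OF step])
      fix k assume "k \<ge> N"
      then show "0 \<le> w (Suc k) * r (Suc k) \<and> w (Suc k) * r (Suc k) \<le> w k * r k"
        using wr_dec wr_ge[of "Suc k"] P by auto
    next
      fix k
      show "0 \<le> s * (f (y k) - f xs)"
        using min[OF yR] H by simp
    qed (use k assms(8) w_dec in auto)

    have start: "2 * (w N * r N) * (\<alpha> N * (\<alpha> N - 1)) * (s * (f (y N) - f xs)) + w N * (norm (z N - xs))\<^sup>2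
        \<le> C1 * R\<^sup>2"
    proof -
      have xN: "norm (x N - xs) \<le> M * R" and yN: "norm (y N - xs) \<le> M * R"
        using bound[OF H] by (auto simp: x_def y_def R_def)
      have "s * (f (y N) - f xs) \<le> s * (L * (norm (y N - xs))\<^sup>2)"
        using gap_le_minimizer[OF H(1-3) yR] H by (intro mult_left_mono) auto
      also have "\<dots> \<le> C0 * (norm (y N - xs))\<^sup>2"
        using mult_right_mono[OF sL, of "(norm (y N - xs))\<^sup>2"] by (simp add: mult.assoc)
      also have "\<dots> \<le> C0 * (M * R)\<^sup>2"
        using yN C0 by (intro mult_left_mono power_mono) auto
      finally have 1: "s * (f (y N) - f xs) \<le> C0 * (M * R)\<^sup>2" .
      have "z N - xs = \<alpha> N *\<^sub>R (x N - xs) - (\<alpha> N - 1) *\<^sub>R (y N - xs)"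
        by (simp add: z_def auxB_def x_def y_def algebra_simps)
      then have "norm (z N - xs) \<le> \<alpha> N * norm (x N - xs) + (\<alpha> N - 1) * norm (y N - xs)"
        using norm_triangle_ineq4[of "\<alpha> N *\<^sub>R (x N - xs)" "(\<alpha> N - 1) *\<^sub>R (y N - xs)"] \<alpha>1[of N] by simp
      also have "\<dots> \<le> \<alpha> N * (M * R) + (\<alpha> N - 1) * (M * R)"
        using xN yN \<alpha>1[of N] by (intro add_mono mult_left_mono) auto
      finally have 2: "(norm (z N - xs))\<^sup>2 \<le> (\<alpha> N * (M * R) + (\<alpha> N - 1) * (M * R))\<^sup>2"
        by (intro power_mono) auto
      have "2 * (w N * r N) * (\<alpha> N * (\<alpha> N - 1)) * (s * (f (y N) - f xs)) + w N * (norm (z N - xs))\<^sup>2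
          \<le> 2 * (w N * r N) * (\<alpha> N * (\<alpha> N - 1)) * (C0 * (M * R)\<^sup>2)
            + w N * (\<alpha> N * (M * R) + (\<alpha> N - 1) * (M * R))\<^sup>2"
        using w_pos[of N] r_pos[of N] \<alpha>1[of N] 1 2 by (intro add_mono mult_left_mono) auto
      also have "\<dots> = C1 * R\<^sup>2"
        by (simp add: C1_def algebra_simps power2_eq_square)
      finally show ?thesis .
    qed

    \<comment> \<open>From the energy to the two rates\<close>
    have weight: "P * c\<^sup>2 * (real i)\<^sup>2 \<le> (w i * r i) * (\<alpha> i)\<^sup>2" if "i \<ge> N" for i
    proof -
      have "(c * real i)\<^sup>2 \<le> (\<alpha> i)\<^sup>2"
        using \<alpha>N[OF that] c by (intro power_mono) auto
      then show ?thesis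
        using mult_mono[OF wr_ge[OF that], of "(c * real i)\<^sup>2" "(\<alpha> i)\<^sup>2"] P wr_ge[OF that]
        by (simp add: power_mult_distrib mult.assoc)
    qed
    have kN: "k \<ge> N" "real k > 0" using k N1 by auto
    have G0: "G i \<ge> 0" for i by (simp add: G_def)
    have gap0: "s * (f (y (Suc k)) - f xs) \<ge> 0" using min[OF yR] H by simp
    have Pc: "P * c\<^sup>2 > 0" using P c by simp
    have QR: "C1 * R\<^sup>2 \<le> P * c\<^sup>2 * (Q * R\<^sup>2)"
      using P c by (simp add: Q_def field_simps)

    have term_ge: "e * (P * c\<^sup>2 * (real i)\<^sup>2) * G i \<le> e * (w i * r i) * (\<alpha> i)\<^sup>2 * G i" if "i \<ge> N" for i
      using mult_left_mono[OF mult_right_mono[OF weight[OF that] G0[of i]], of e] e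
      by (simp add: mult.assoc)
    have sum_le: "(\<Sum>i=N..k. e * (P * c\<^sup>2 * (real i)\<^sup>2) * G i) \<le> (\<Sum>i=N..k. e * (w i * r i) * (\<alpha> i)\<^sup>2 * G i)"
      by (intro sum_mono term_ge) auto
    have lead_ge: "2 * (P * c\<^sup>2 * (real k)\<^sup>2) * (s * (f (y (Suc k)) - f xs))
        \<le> 2 * (w k * r k) * (\<alpha> k)\<^sup>2 * (s * (f (y (Suc k)) - f xs))"
      using mult_right_mono[OF weight[OF kN(1)] gap0] by (simp add: mult.assoc)
    have "w k * (norm (z (Suc k) - xs))\<^sup>2 \<ge> 0"
      using w_pos[OF kN(1)] by simp
    then have main: "2 * (P * c\<^sup>2 * (real k)\<^sup>2) * (s * (f (y (Suc k)) - f xs))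
        + (\<Sum>i=N..k. e * (P * c\<^sup>2 * (real i)\<^sup>2) * G i) \<le> P * c\<^sup>2 * (Q * R\<^sup>2)"
      using energy start sum_le lead_ge QR by linarith
    have factor: "2 * (P * c\<^sup>2 * (real k)\<^sup>2) * (s * (f (y (Suc k)) - f xs))
        = P * c\<^sup>2 * (2 * (real k)\<^sup>2 * (s * (f (y (Suc k)) - f xs)))"
      "(\<Sum>i=N..k. e * (P * c\<^sup>2 * (real i)\<^sup>2) * G i) = P * c\<^sup>2 * (e * (\<Sum>i=N..k. (real i)\<^sup>2 * G i))"
      by (simp_all add: sum_distrib_left mult_ac)
    have nonneg: "2 * (real k)\<^sup>2 * (s * (f (y (Suc k)) - f xs)) \<ge> 0"
      "e * (\<Sum>i=N..k. (real i)\<^sup>2 * G i) \<ge> 0"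
      using gap0 e G0 by (auto intro!: mult_nonneg_nonneg sum_nonneg)
    have "2 * (real k)\<^sup>2 * (s * (f (y (Suc k)) - f xs)) + e * (\<Sum>i=N..k. (real i)\<^sup>2 * G i) \<le> Q * R\<^sup>2"
      using main Pc unfolding factor distrib_left[symmetric] by (simp only: mult_le_cancel_left_pos)
    then have lead: "2 * (real k)\<^sup>2 * (s * (f (y (Suc k)) - f xs)) \<le> Q * R\<^sup>2"
      and sum: "(\<Sum>i=N..k. (real i)\<^sup>2 * G i) \<le> Q * R\<^sup>2 / e"
      using nonneg e by (auto simp: field_simps)

    \<comment> \<open>The last summand alone controls the loss in passing from
      \<open>y (Suc k)\<close> back to \<open>x k\<close>, which is at most \<open>B * G k\<close>
      after multiplication by \<open>s\<close>.\<close>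
    have "(real k)\<^sup>2 * G k \<le> (\<Sum>i=N..k. (real i)\<^sup>2 * G i)"
      using kN G0 by (intro member_le_sum) auto
    then have Gk: "(real k)\<^sup>2 * G k \<le> Q * R\<^sup>2 / e"
      using sum by linarith
    have "f (x k) - f (y (Suc k)) \<le> \<beta> k * s * (norm (g k))\<^sup>2"
      using F1_above_tangent[OF H(2) xR[of k] yR[of "Suc k"]]
      by (simp add: y_Suc g_def power2_norm_eq_inner)
    also have "\<dots> \<le> B * s * (norm (g k))\<^sup>2"
      using \<beta>_le[of k] H by (intro mult_right_mono) auto
    finally have "s * (f (x k) - f (y (Suc k))) \<le> s * (B * s * (norm (g k))\<^sup>2)"
      using H by (intro mult_left_mono) auto
    also have "\<dots> = B * G k"
      by (simp add: G_def power2_eq_square)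
    finally have "(real k)\<^sup>2 * (s * (f (x k) - f (y (Suc k)))) \<le> B * ((real k)\<^sup>2 * G k)"
      using mult_left_mono[of "s * (f (x k) - f (y (Suc k)))" "B * G k" "(real k)\<^sup>2"] by (simp add: mult_ac)
    also have "\<dots> \<le> B * (Q * R\<^sup>2 / e)"
      using Gk B by (intro mult_left_mono) auto
    finally have "(real k)\<^sup>2 * (s * (f (x k) - f xs)) \<le> Q * R\<^sup>2 + B * (Q * R\<^sup>2 / e)"
      using lead nonneg(1) by (simp add: algebra_simps)
    also have "\<dots> \<le> C * R\<^sup>2"
      using Q e by (simp add: C_def algebra_simps)
    finally have value_rate: "f (x k) - f xs \<le> C * (R\<^sup>2 / (s * (real k)\<^sup>2))"
      using kN H by (simp add: field_simps)

    define m where "m = (MIN i\<in>{0..k}. (norm (g i))\<^sup>2)"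
    have m_le: "m \<le> (norm (g i))\<^sup>2" if "i \<le> k" for i
      unfolding m_def using that by (intro Min_le) auto
    have "m \<ge> 0" unfolding m_def by (simp add: Min_ge_iff)
    \<comment> \<open>Each \<open>G i\<close> with \<open>i\<close> in \<open>N..k\<close> is at
      least \<open>s\<^sup>2 * m\<close>, so the bounded weighted sum dominates \<open>m\<close>
      times a sum of squares of cubic growth.\<close>
    then have "s\<^sup>2 * m * (real k + 1) ^ 3 \<le> s\<^sup>2 * m * (28 * (\<Sum>i=N..k. (real i)\<^sup>2))"
      using cube_le_sum_squares[OF N1 k] by (intro mult_left_mono) auto
    also have "\<dots> = 28 * (\<Sum>i=N..k. (real i)\<^sup>2 * (s\<^sup>2 * m))"
      by (simp add: sum_distrib_left mult_ac)
    also have "\<dots> \<le> 28 * (\<Sum>i=N..k. (real i)\<^sup>2 * G i)"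
      unfolding G_def by (intro mult_left_mono sum_mono m_le) auto
    also have "\<dots> \<le> 28 * (Q * R\<^sup>2 / e)"
      using sum by simp
    also have "\<dots> \<le> C * R\<^sup>2"
      using Q e B by (simp add: C_def algebra_simps)
    finally have "m \<le> C * (R\<^sup>2 / (s\<^sup>2 * (real k + 1) ^ 3))"
      using H by (simp add: field_simps add_pos_pos)
    with value_rate show ?thesis
      by (simp add: iterB_def x_def g_def m_def R_def)
  qed
  \<comment> \<open>The threshold \<open>2 * N\<close> is the one that
    \<open>cube_le_sum_squares\<close> demands.\<close>
  show ?thesis
    using C C0 N1 rates by (intro exI[of _ C] conjI exI[of _ C0] exI[of _ "2 * N"]) auto
qed

end
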